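(* Let $q$ be a prime power and $m,n$ positive integers. If $h_q(mn)=0$, then $h_{\tau_3}(\mathbb{F}_q^{mn})=0$, and hence $h_{q^m}(n)=0$. Similarly, if $h_q(mn)\le m-1$, then $h_{q^m}(n)=0$.
   Context: For a prime power $Q$ and $N\in\mathbb{N}$, with $\tau$ the cyclic shift $(u_1,\dots,u_N)\mapsto(u_N,u_1,\dots,u_{N-1})$ on $\mathbb{F}_Q^N$, a subspace $U$ is cyclically covering if $\bigcup_{i=0}^{N-1}\tau^i(U)=\mathbb{F}_Q^N$, and $h_Q(N)$ is the largest codimension of a cyclically covering subspace of $\mathbb{F}_Q^N$. Write vectors of $\mathbb{F}_q^{mn}$ as $(b_1,\dots,b_n)$ with blocks $b_i\in\mathbb{F}_q^m$ and let $\tau_3(b_1,\dots,b_n)=(b_n,b_1,\dots,b_{n-1})$. A subspace $U\subseteq\mathbb{F}_q^{mn}$ is a $\tau_3$-covering if $\bigcup_{k=0}^{n-1}\tau_3^k(U)=\mathbb{F}_q^{mn}$, and $h_{\tau_3}(\mathbb{F}_q^{mn})$ is the largest codimension of a $\tau_3$-covering subspace. *)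

theory Defs
  imports "HOL-Library.Cardinality" "Jordan_Normal_Form.VS_Connect"
begin

definition is_subspace :: "nat \<Rightarrow> 'a::field vec set \<Rightarrow> bool" where
  "is_subspace N U \<longleftrightarrow> subspace class_ring U (module_vec TYPE('a) N)"

definition codimension :: "nat \<Rightarrow> 'a::field vec set \<Rightarrow> nat" where
  "codimension N U = N - vectorspace.dim class_ring ((module_vec TYPE('a) N)\<lparr>carrier := U\<rparr>)"

definition is_covering :: "('a vec \<Rightarrow> 'a vec) \<Rightarrow> nat \<Rightarrow> nat \<Rightarrow> 'a::field vec set \<Rightarrow> bool" where
  "is_covering T k N U \<longleftrightarrow>
     is_subspace N U \<and> (\<Union>i\<in>{0..<k}. (T ^^ i) ` U) = carrier_vec N"

text \<open>Indices are 0-based: \<open>(u\<^sub>1, \<dots>, u\<^sub>N)\<close> has \<open>u\<^sub>i\<close> at position \<open>i - 1\<close>.\<close>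

definition cyclic_shift :: "nat \<Rightarrow> 'a vec \<Rightarrow> 'a vec" where
  "cyclic_shift N u = vec N (\<lambda>i. if i = 0 then u $ (N - 1) else u $ (i - 1))"

definition block :: "nat \<Rightarrow> 'a vec \<Rightarrow> nat \<Rightarrow> 'a vec" where
  "block m v i = vec m (\<lambda>r. v $ (i * m + r))"

definition of_blocks :: "nat \<Rightarrow> nat \<Rightarrow> (nat \<Rightarrow> 'a vec) \<Rightarrow> 'a vec" where
  "of_blocks m n b = vec (m * n) (\<lambda>j. b (j div m) $ (j mod m))"

definition tau3 :: "nat \<Rightarrow> nat \<Rightarrow> 'a vec \<Rightarrow> 'a vec" where
  "tau3 m n v = of_blocks m n (\<lambda>i. if i = 0 then block m v (n - 1) else block m v (i - 1))"

text \<open>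
  \<open>h_cyclic TYPE('a) N\<close> is \<open>h\<^sub>Q(N)\<close>, where \<open>'a\<close> is the field with \<open>Q = CARD('a)\<close> elements.
  Both maxima range over nonempty sets when \<open>N\<close>, respectively \<open>n\<close>, is positive:
  the whole space is covering.
\<close>

definition h_cyclic :: "'a::{field,finite} itself \<Rightarrow> nat \<Rightarrow> nat" where
  "h_cyclic _ N = Max {codimension N U | U :: 'a vec set. is_covering (cyclic_shift N) N N U}"

definition h_tau3 :: "'a::{field,finite} itself \<Rightarrow> nat \<Rightarrow> nat \<Rightarrow> nat" where
  "h_tau3 _ m n =
     Max {codimension (m * n) U | U :: 'a vec set. is_covering (tau3 m n) n (m * n) U}"

lemma finite_codimensions: "finite {codimension N U | U. P U}"
  by (rule finite_subset[of _ "{..N}"]) (auto simp: codimension_def)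

lemma is_covering_carrier_vec:
  assumes "k > 0" and T: "\<And>v. v \<in> carrier_vec N \<Longrightarrow> T v \<in> carrier_vec N"
  shows "is_covering T k N (carrier_vec N :: 'a::field vec set)"
proof -
  interpret vec_space "TYPE('a)" N .
  have "subspace class_ring (carrier_vec N :: 'a vec set) V"
    using span_is_subspace[of "set (unit_vecs N)"] span_unit_vecs_is_carrier unit_vecs_carrier
    by auto
  moreover have "(T ^^ i) ` carrier_vec N \<subseteq> carrier_vec N" for i
    by (induction i) (auto intro: T)
  moreover have "(carrier_vec N :: 'a vec set) = (T ^^ 0) ` carrier_vec N"
    by simp
  ultimately show ?thesis
    using \<open>k > 0\<close> unfolding is_covering_def is_subspace_def
    by (metis (no_types, lifting) SUP_least UN_upper atLeastLessThan_iff le0 subset_antisym)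
qed

end

theory Submission
  imports Defs "Jordan_Normal_Form.Char_Poly" "HOL-Algebra.Sylow" "HOL-Number_Theory.Residues"
begin

text \<open>
  The block shift \<open>\<tau>\<^sub>3\<close> is the \<open>m\<close>-th power of the cyclic shift on \<open>F\<^sub>q\<^sup>m\<^sup>n\<close>, so a
  \<open>\<tau>\<^sub>3\<close>-covering subspace is cyclically covering. Choosing an \<open>F\<^sub>q\<close>-basis of the field with \<open>q\<^sup>m\<close>
  elements identifies its \<open>n\<close>-th power with \<open>F\<^sub>q\<^sup>m\<^sup>n\<close> and the cyclic shift with \<open>\<tau>\<^sub>3\<close>; the codimension
  of a subspace is thereby multiplied by \<open>m\<close>. Hence \<open>m h\<close> is at most \<open>h\<^sub>q(mn)\<close>, where \<open>h\<close> is the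
  maximum over the larger field. As the two fields are unrelated types, an embedding of the
  smaller into the larger one has to be constructed: it sends a generator \<open>g\<close> of the
  multiplicative group to a root of the minimal polynomial of \<open>g\<close> over the prime field.
\<close>

hide_const (open) up_ring.coeff up_ring.monom

section \<open>Characteristic and multiplicative group of a finite field\<close>

lemma CARD_field_gt_1: "CARD('a::{field,finite}) > 1"
  using card_mono[of UNIV "{0, 1 :: 'a}"] by simp

text \<open>Cauchy's theorem for the additive group, taken from Sylow's theorem with exponent 1: a
  subgroup of order \<open>r\<close> contains some \<open>x \<noteq> 0\<close> with
  \<open>of_nat r * x = 0\<close>. Hence the characteristic divides the prime \<open>r\<close>, and
  it is not 1.\<close>

lemma CHAR_eq_prime_divisor_CARD:
  assumes "prime r" and "r dvd CARD('a::{field,finite})"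
  shows "CHAR('a) = r"
proof -
  define G where "G = \<lparr>carrier = (UNIV :: 'a set), monoid.mult = (+), one = (0 :: 'a)\<rparr>"
  interpret G: group G
  proof (rule groupI)
    fix x assume "x \<in> carrier G"
    show "\<exists>y\<in>carrier G. y \<otimes>\<^bsub>G\<^esub> x = \<one>\<^bsub>G\<^esub>"
      by (intro bexI[of _ "-x"]) (auto simp: G_def)
  qed (auto simp: G_def add_ac)
  have pow: "x [^]\<^bsub>G\<^esub> k = of_nat k * x" for x and k :: nat
    by (induction k) (auto simp: G_def algebra_simps)
  obtain s where "CARD('a) = r ^ 1 * s"
    using assms(2) by auto
  then obtain H where H: "subgroup H G" "card H = r"
    using sylow_thm[OF \<open>prime r\<close> G.group_axioms, of 1 s] by (auto simp: Coset.order_def G_def)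
  have "0 \<in> H"
    using subgroup.one_closed[OF H(1)] by (simp add: G_def)
  moreover have "card H > card {0 :: 'a}"
    using prime_gt_1_nat[OF \<open>prime r\<close>] H(2) by simp
  ultimately obtain x where "x \<in> H" "x \<noteq> 0"
    by (metis (no_types, lifting) card_mono finite.emptyI finite_insert linorder_not_le singletonI subsetI)
  interpret H: group "G\<lparr>carrier := H\<rparr>"
    using H(1) G.group_axioms by (rule subgroup.subgroup_is_group)
  have "x [^]\<^bsub>G\<lparr>carrier := H\<rparr>\<^esub> r = \<one>\<^bsub>G\<lparr>carrier := H\<rparr>\<^esub>"
    using H.pow_order_eq_1[of x] \<open>x \<in> H\<close> H(2) by (simp add: Coset.order_def)
  then have "of_nat r * x = 0"
    by (simp add: G_def nat_pow_def pow[unfolded G_def nat_pow_def, simplified])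
  then have "CHAR('a) dvd r"
    using \<open>x \<noteq> 0\<close> by (simp add: of_nat_eq_0_iff_char_dvd)
  then show ?thesis
    using \<open>prime r\<close> CHAR_not_1'[where ?'a = 'a] by (auto simp: prime_nat_iff)
qed

lemma prime_CHAR_finite_field: "prime CHAR('a::{field,finite})"
proof (rule prime_CHAR_semidom)
  show "CHAR('a) > 0"
    by (rule finite_imp_CHAR_pos) simp
qed

text \<open>The characteristic of \<open>'b\<close> is a prime dividing a power of
  \<open>CARD('a)\<close>, hence a prime divisor of \<open>CARD('a)\<close> itself, and the only
  such prime is \<open>CHAR('a)\<close>.\<close>

lemma CHAR_eq_if_CARD_eq_power:
  assumes "CARD('b::{field,finite}) = CARD('a::{field,finite}) ^ m"
  shows "CHAR('b) = CHAR('a)"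
proof -
  have "CHAR('b) dvd CARD('a)"
    using assms CHAR_dvd_CARD[where ?'a='b] prime_dvd_power[OF prime_CHAR_finite_field[where ?'a='b]]
    by metis
  then show ?thesis
    using CHAR_eq_prime_divisor_CARD[OF prime_CHAR_finite_field] by metis
qed

text \<open>The multiplicative group is cyclic. Reducing exponents modulo its order shows that the
  listed powers reach every nonzero element, and counting then makes them distinct.\<close>

lemma finite_field_generator:
  obtains g :: "'a::{field,finite}" where "bij_betw (\<lambda>i. g ^ i) {..<CARD('a) - 1} (UNIV - {0})"
    and "g ^ (CARD('a) - 1) = 1"
proof -
  let ?R = "class_ring :: 'a ring"
  interpret M: group "mult_of ?R"
    by (rule field.field_mult_group[OF class_field])
  have pow: "a [^]\<^bsub>?R\<^esub> k = a ^ k" for a and k :: nat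
    by (simp add: class_ring_simps)
  have fin: "finite (carrier ?R)" by simp
  obtain g where g: "g \<in> carrier (mult_of ?R)"
    and gen: "carrier (mult_of ?R) = {g [^]\<^bsub>?R\<^esub> i | i :: nat. i \<in> UNIV}"
    using field.finite_field_mult_group_has_gen[OF class_field fin] by (rule bexE)
  have "g [^]\<^bsub>mult_of ?R\<^esub> Coset.order (mult_of ?R) = \<one>\<^bsub>mult_of ?R\<^esub>"
    by (rule M.pow_order_eq_1[OF g])
  then have g1: "g ^ (CARD('a) - 1) = 1"
    unfolding nat_pow_mult_of pow by (simp add: Coset.order_def card_Diff_singleton)
  have pos: "CARD('a) - 1 > 0"
    using CARD_field_gt_1[where ?'a = 'a] by simp
  have im: "(\<lambda>i. g ^ i) ` {..<CARD('a) - 1} = UNIV - {0}"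
  proof (intro equalityI subsetI)
    fix x :: 'a assume "x \<in> UNIV - {0}"
    then have "x \<in> carrier (mult_of ?R)" by simp
    then obtain i where "x = g ^ i"
      unfolding gen pow by (auto simp only: mem_Collect_eq UNIV_I simp_thms)
    also have "\<dots> = g ^ (i mod (CARD('a) - 1) + (CARD('a) - 1) * (i div (CARD('a) - 1)))"
      by (simp only: mod_mult_div_eq)
    also have "\<dots> = g ^ (i mod (CARD('a) - 1))"
      by (simp only: power_add power_mult g1 power_one mult_1_right)
    finally show "x \<in> (\<lambda>i. g ^ i) ` {..<CARD('a) - 1}" using pos by auto
  qed (use g in auto)
  then have "inj_on (\<lambda>i. g ^ i) {..<CARD('a) - 1}"
    by (intro eq_card_imp_inj_on) (auto simp: card_Diff_singleton)
  with im g1 show thesis by (intro that) (auto simp: bij_betw_def)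
qed

text \<open>For a generator \<open>g\<close> and \<open>e = (CARD('a) - 1) / d\<close>, the powers
  \<open>g ^ (e * j)\<close> with \<open>j < d\<close> are distinct \<open>d\<close>-th roots of
  unity.\<close>

lemma card_roots_of_unity_finite_field:
  assumes "d dvd CARD('a::{field,finite}) - 1"
  shows "d \<le> card {x :: 'a. x ^ d = 1}"
proof -
  obtain g :: 'a where g: "bij_betw (\<lambda>i. g ^ i) {..<CARD('a) - 1} (UNIV - {0})"
    and g1: "g ^ (CARD('a) - 1) = 1" by (rule finite_field_generator)
  obtain e where e: "CARD('a) - 1 = d * e" using assms by auto
  have pos: "CARD('a) - 1 > 0"
    using CARD_field_gt_1[where ?'a = 'a] by simp
  then have "e > 0" using e by (cases e) auto
  have "inj_on (\<lambda>j. g ^ (e * j)) {..<d}"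
  proof (rule inj_onI)
    fix i j assume *: "i \<in> {..<d}" "j \<in> {..<d}" "g ^ (e * i) = g ^ (e * j)"
    then have "e * i < CARD('a) - 1" "e * j < CARD('a) - 1"
      using e \<open>e > 0\<close> by (auto simp: mult.commute)
    then have "e * i = e * j"
      using inj_onD[OF bij_betw_imp_inj_on[OF g] *(3)] by simp
    then show "i = j" using \<open>e > 0\<close> by simp
  qed
  moreover have "(\<lambda>j. g ^ (e * j)) ` {..<d} \<subseteq> {x. x ^ d = 1}"
    by (auto simp: g1 e[symmetric] simp flip: power_mult)
       (metis e g1 mult.commute mult.assoc power_mult power_one)
  ultimately show ?thesis
    by (metis card_inj_on_le card_lessThan finite)
qed

section \<open>Embedding a finite field into a larger one\<close>

text \<open>
  Polynomials over the prime field are represented by integer polynomials, which can be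
  evaluated in every field without choosing an isomorphism of prime fields.
\<close>

lemma minimal_int_poly:
  fixes g :: "'a::{field,finite}"
  assumes "g ^ k = 1" and "k > 0"
  obtains f :: "int poly" where "lead_coeff f = 1" and "poly (of_int_poly f) g = 0"
    and "\<And>P. poly (of_int_poly P) g = 0 \<Longrightarrow> \<exists>s t. P = f * s + [:int CHAR('a):] * t"
proof -
  let ?p = "int CHAR('a)"
  have "prime ?p"
    using prime_CHAR_finite_field[where ?'a = 'a] by simp
  \<comment> \<open>An element of \<open>M\<close> of least degree is a monic integer lift of the
    minimal polynomial of \<open>g\<close> over the prime field. That \<open>M\<close> is inhabited
    is witnessed by \<open>monom 1 k - 1\<close>.\<close>
  define M where "M f \<longleftrightarrow> lead_coeff f = 1 \<and> poly (of_int_poly f) g = 0" for f :: "int poly"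
  have "degree (monom 1 k - 1 :: int poly) = k"
    using \<open>k > 0\<close> by (intro antisym degree_le le_degree) (auto simp: coeff_1)
  then have "M (monom 1 k - 1)"
    using assms by (simp add: M_def poly_monom of_int_poly_hom.hom_minus)
  then obtain f where "M f" and least: "\<And>f'. M f' \<Longrightarrow> degree f \<le> degree f'"
    using ex_has_least_nat[of M _ degree] by blast
  have "\<exists>s t. P = f * s + [:?p:] * t" if P: "poly (of_int_poly P) g = 0" for P
  proof -
    \<comment> \<open>Pseudo-division scales \<open>P\<close> by a power of the leading coefficient
      of \<open>f\<close>. As this is 1, it is an exact division with remainder over the
      integers.\<close>
    obtain s r where sr: "pseudo_divmod P f = (s, r)" by fastforce
    have "f \<noteq> 0" using \<open>M f\<close> by (auto simp: M_def)
    then have P_eq: "P = f * s + r" and r: "r = 0 \<or> degree r < degree f"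
      using pseudo_divmod[OF _ sr] \<open>M f\<close> by (auto simp: M_def)
    have r0: "poly (of_int_poly r) g = 0"
      using P \<open>M f\<close> by (simp add: P_eq M_def of_int_poly_hom.hom_add of_int_poly_hom.hom_mult)
    \<comment> \<open>Otherwise, \<open>r\<close> becomes monic modulo \<open>p\<close> after multiplication by an inverse of its top
      coefficient modulo \<open>p\<close>, contradicting the minimality of \<open>degree f\<close>.\<close>
    have "?p dvd coeff r i" for i
    proof (rule ccontr)
      assume i: "\<not> ?p dvd coeff r i"
      then have "r \<noteq> 0" by auto
      define k where "k = (GREATEST k. \<not> ?p dvd coeff r k)"
      have bound: "j \<le> degree r" if "\<not> ?p dvd coeff r j" for j
        using that by (intro le_degree) auto
      have k: "\<not> ?p dvd coeff r k"
        unfolding k_def by (rule GreatestI_nat[of _ i "degree r"]) (use i bound in auto)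
      have above: "?p dvd coeff r j" if "k < j" for j
        using that bound Greatest_le_nat[of "\<lambda>j. \<not> ?p dvd coeff r j" j "degree r"]
        by (auto simp: k_def)
      obtain c where c: "[coeff r k * c = 1] (mod ?p)"
        using cong_solve_coprime_int prime_imp_coprime[OF \<open>prime ?p\<close> k] by (metis coprime_commute)
      \<comment> \<open>Over the integers, \<open>smult c r\<close> need not be monic of degree
        \<open>k\<close>: its coefficient at \<open>k\<close> is only congruent to 1, and those
        above are only divisible by \<open>p\<close>. \<open>w\<close> corrects both without
        changing the image over \<open>'a\<close>.\<close>
      define w where "w = Poly (map (\<lambda>j. if j < k then c * coeff r j else 1) [0..<Suc k])"
      have cw: "coeff w j = (if j < k then c * coeff r j else if j = k then 1 else 0)" for j
        by (auto simp: w_def nth_default_def simp del: upt_Suc)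
      have dw: "degree w = k"
        by (intro antisym degree_le le_degree) (auto simp: cw)
      have "(of_int_poly w :: 'a poly) = of_int_poly (smult c r)"
      proof (rule poly_eqI)
        fix j
        consider "j < k" | "j = k" | "k < j" by linarith
        then have "(of_int (coeff w j) :: 'a) = of_int (c * coeff r j)"
        proof cases
          case 2
          have "(of_int (coeff r k * c) :: 'a) = of_int 1"
            using c unfolding of_int_eq_iff_cong_CHAR .
          with 2 show ?thesis by (simp add: cw mult.commute)
        next
          case 3
          with above[of j] have "(of_int (coeff r j) :: 'a) = 0"
            by (simp add: of_int_eq_0_iff_char_dvd)
          with 3 show ?thesis by (simp add: cw)
        qed (simp add: cw)
        then show "coeff (of_int_poly w :: 'a poly) j = coeff (of_int_poly (smult c r)) j"
          by (simp add: coeff_map_poly)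
      qed
      also have "\<dots> = smult (of_int c) (of_int_poly r)"
        by (rule poly_eqI) (simp add: coeff_map_poly)
      finally have "M w"
        using r0 by (simp add: M_def dw cw)
      with least[of w] have "degree f \<le> k" by (simp add: dw)
      with bound[OF k] r \<open>r \<noteq> 0\<close> show False by simp
    qed
    then have "[:?p:] dvd r" by (simp add: const_poly_dvd_iff)
    then show ?thesis unfolding P_eq by (metis dvdE)
  qed
  with \<open>M f\<close> show thesis by (intro that) (auto simp: M_def)
qed

text \<open>\<open>h\<close> is a root in \<open>'b\<close> of the lifted minimal polynomial
  \<open>f\<close> of \<open>g\<close>. Over \<open>'b\<close> the polynomial
  \<open>monom 1 d - 1\<close> factors as \<open>?F * S\<close>. If \<open>?F\<close> had no root,
  at least \<open>d\<close> roots of unity would be roots of \<open>S\<close>, so \<open>?F\<close>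
  would have degree 0 and \<open>f\<close> would be the constant 1, which does not vanish at
  \<open>g\<close>.\<close>

lemma conjugate_in_larger_finite_field:
  fixes g :: "'a::{field,finite}"
  assumes "CHAR('b::{field,finite}) = CHAR('a)" and "d dvd CARD('b::{field,finite}) - 1" and "d > 0" and "g ^ d = 1"
  obtains h :: "'b::{field,finite}" where "\<And>P. poly (of_int_poly P) g = 0 \<Longrightarrow> poly (of_int_poly P) h = 0"
proof -
  obtain f where f: "lead_coeff f = 1" "poly (of_int_poly f) g = 0"
    and min: "\<And>P. poly (of_int_poly P) g = 0 \<Longrightarrow> \<exists>s t. P = f * s + [:int CHAR('a):] * t"
    using minimal_int_poly[OF assms(4,3)] by blast
  \<comment> \<open>Equality of the characteristics enters here: the second generator
    \<open>p\<close> of the vanishing ideal dies over \<open>'b\<close> as well, so only the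
    multiple of \<open>f\<close> survives.\<close>
  have p0: "of_int_poly [:int CHAR('a):] = (0 :: 'b poly)"
    by (rule poly_eqI) (simp add: coeff_map_poly coeff_pCons flip: assms(1) split: nat.split)
  let ?F = "of_int_poly f :: 'b poly"
  have factor: "\<exists>S. of_int_poly P = ?F * S" if "poly (of_int_poly P) g = 0" for P
  proof -
    obtain s t where "P = f * s + [:int CHAR('a):] * t"
      using min[OF \<open>poly (of_int_poly P) g = 0\<close>] by blast
    then have "of_int_poly P = ?F * of_int_poly s + of_int_poly [:int CHAR('a):] * of_int_poly t"
      by (simp only: of_int_poly_hom.hom_add of_int_poly_hom.hom_mult)
    then show ?thesis unfolding p0 by auto
  qed
  have "\<exists>h. poly ?F h = 0"
  proof (rule ccontr)
    assume no_root: "\<not> (\<exists>h. poly ?F h = 0)"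
    have "poly (of_int_poly (monom 1 d - 1)) g = 0"
      using assms(4) by (simp add: of_int_poly_hom.hom_minus poly_monom)
    then obtain S where S: "of_int_poly (monom 1 d - 1) = ?F * S"
      using factor by blast
    have FS: "monom 1 d - 1 = ?F * S"
      unfolding S[symmetric] by (simp add: of_int_poly_hom.hom_minus)
    have deg: "degree (monom 1 d - 1 :: 'b poly) = d"
      using \<open>d > 0\<close> by (intro antisym degree_le le_degree) (auto simp: coeff_1)
    then have "?F * S \<noteq> 0" using FS \<open>d > 0\<close> by (metis degree_0 less_irrefl)
    then have "?F \<noteq> 0" "S \<noteq> 0" by auto
    have "{x :: 'b. x ^ d = 1} \<subseteq> {x. poly S x = 0}"
    proof safe
      fix x :: 'b assume "x ^ d = 1"
      then have "poly (?F * S) x = 0" unfolding FS[symmetric] by (simp add: poly_monom)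
      then show "poly S x = 0" using no_root by auto
    qed
    then have "card {x :: 'b. x ^ d = 1} \<le> degree S"
      using card_mono[OF poly_roots_finite[OF \<open>S \<noteq> 0\<close>]] card_poly_roots_bound[OF \<open>S \<noteq> 0\<close>]
      by (meson le_trans)
    then have "d \<le> degree S"
      using card_roots_of_unity_finite_field[OF assms(2)] by linarith
    moreover have "d = degree ?F + degree S"
      using deg \<open>?F \<noteq> 0\<close> \<open>S \<noteq> 0\<close> unfolding FS by (simp add: degree_mult_eq)
    moreover have "degree ?F = degree f"
      by (rule map_poly_degree_eq) (use f in auto)
    ultimately have "degree f = 0" by simp
    with f show False by (auto elim!: degree_eq_zeroE)
  qed
  then obtain h where "poly ?F h = 0" ..
  with factor show thesis by (intro that[of h]) (metis mult_zero_left poly_mult)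
qed

text \<open>Every \<open>x\<close> is the value at \<open>g\<close> of some integer polynomial
  \<open>P x\<close>, and is sent to the value of \<open>P x\<close> at the conjugate
  \<open>h\<close>. Integer polynomials that agree at \<open>g\<close> agree at \<open>h\<close>, so
  the choice of \<open>P x\<close> does not matter and sums and products are preserved.\<close>

lemma finite_field_embedding:
  assumes "CARD('b::{field,finite}) = CARD('a::{field,finite}) ^ m"
  obtains \<phi> :: "'a::{field,finite} \<Rightarrow> 'b::{field,finite}" where "\<phi> 1 = 1" and "\<And>x y. \<phi> (x + y) = \<phi> x + \<phi> y"
    and "\<And>x y. \<phi> (x * y) = \<phi> x * \<phi> y"
proof -
  let ?d = "CARD('a) - 1"
  have "CARD('a) > 1"
    by (rule CARD_field_gt_1)
  \<comment> \<open>The geometric sum is taken over the integers to avoid truncated subtraction. The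
    resulting divisibility provides enough roots of unity in \<open>'b\<close>.\<close>
  then have "int (CARD('b) - 1) = int ?d * (\<Sum>i<m. int CARD('a) ^ i)"
    using power_diff_1_eq[of "int CARD('a)" m] by (simp add: assms of_nat_diff)
  then have dvd: "?d dvd CARD('b) - 1"
    by (metis dvd_triv_left of_nat_dvd_iff)
  obtain g :: 'a where g: "bij_betw (\<lambda>i. g ^ i) {..<CARD('a) - 1} (UNIV - {0})"
    and g1: "g ^ (CARD('a) - 1) = 1" by (rule finite_field_generator)
  obtain h :: 'b where h: "\<And>P. poly (of_int_poly P) g = 0 \<Longrightarrow> poly (of_int_poly P) h = 0"
    using conjugate_in_larger_finite_field[OF CHAR_eq_if_CARD_eq_power[OF assms] dvd _ g1]
      \<open>CARD('a) > 1\<close> by (metis zero_less_diff)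
  have "\<exists>P. poly (of_int_poly P) g = x" for x
  proof (cases "x = 0")
    case False
    then obtain i where "x = g ^ i" using bij_betw_imp_surj_on[OF g] by blast
    then have "poly (of_int_poly (monom 1 i)) g = x" by (simp add: poly_monom)
    then show ?thesis ..
  qed (auto intro: exI[of _ 0])
  then obtain P where P: "\<And>x. poly (of_int_poly (P x)) g = x" by metis
  have eq: "poly (of_int_poly A) h = poly (of_int_poly B) h"
    if "poly (of_int_poly A) g = poly (of_int_poly B) g" for A B
    using h[of "A - B"] that by (simp add: of_int_poly_hom.hom_minus)
  show thesis
  proof (rule that[of "\<lambda>x. poly (of_int_poly (P x)) h"])
    show "poly (of_int_poly (P 1)) h = 1"
      using eq[of "P 1" 1] by (simp add: P)
    show "poly (of_int_poly (P (x + y))) h = poly (of_int_poly (P x)) h + poly (of_int_poly (P y)) h" for x y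
      using eq[of "P (x + y)" "P x + P y"] by (simp add: P of_int_poly_hom.hom_add)
    show "poly (of_int_poly (P (x * y))) h = poly (of_int_poly (P x)) h * poly (of_int_poly (P y)) h" for x y
      using eq[of "P (x * y)" "P x * P y"] by (simp add: P of_int_poly_hom.hom_mult)
  qed
qed

section \<open>Cardinality, dimension and codimension\<close>

lemma finite_carrier_vec: "finite (carrier_vec n :: 'a::finite vec set)"
proof (rule finite_subset)
  show "carrier_vec n \<subseteq> vec_of_list ` {xs :: 'a list. set xs \<subseteq> UNIV \<and> length xs = n}"
    using vec_list[symmetric] by (force simp: image_iff)
qed (rule finite_imageI[OF finite_lists_length_eq[OF finite]])

text \<open>A finite basis \<open>B\<close> puts the vectors in bijection with their coefficient
  functions. These are taken extensional, since \<open>lincomb\<close> does not see values outside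
  \<open>B\<close>.\<close>

lemma card_finite_vectorspace:
  fixes V :: "('a::{field,finite}, 'v, 'w) module_scheme"
  assumes "vectorspace class_ring V" and finV: "finite (carrier V)"
  shows "card (carrier V) = CARD('a) ^ vectorspace.dim class_ring V"
proof -
  interpret vectorspace class_ring V by fact
  have "span (carrier V) = carrier V"
    using in_own_span[of "carrier V"] span_is_subset2[of "carrier V"] by auto
  then have fin_dim
    using finV unfolding fin_dim_def by (intro exI[of _ "carrier V"]) simp
  then obtain B where B: "finite B" "basis B"
    using finite_basis_exists by blast
  then have "B \<subseteq> carrier V" by (simp add: basis_def)
  have rep: "\<exists>!a. a \<in> B \<rightarrow>\<^sub>E UNIV \<and> lincomb a B = v" if "v \<in> carrier V" for v
    using basis_criterion[OF B(1) \<open>B \<subseteq> carrier V\<close>] B(2) that by simp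
  have lin: "lincomb a B \<in> carrier V" for a
    using \<open>B \<subseteq> carrier V\<close> by (intro lincomb_closed) auto
  have "bij_betw (\<lambda>a. lincomb a B) (B \<rightarrow>\<^sub>E UNIV) (carrier V)"
    unfolding bij_betw_def
  proof (intro conjI inj_onI equalityI subsetI)
    fix a b assume "a \<in> B \<rightarrow>\<^sub>E UNIV" "b \<in> B \<rightarrow>\<^sub>E UNIV" "lincomb a B = lincomb b B"
    then show "a = b" using rep[OF lin[of b]] by blast
  next
    fix v assume "v \<in> carrier V"
    then show "v \<in> (\<lambda>a. lincomb a B) ` (B \<rightarrow>\<^sub>E UNIV)" using rep[of v] by blast
  qed (use lin in blast)
  then have "card (carrier V) = card (B \<rightarrow>\<^sub>E (UNIV :: 'a set))"
    by (simp add: bij_betw_same_card)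
  also have "\<dots> = CARD('a) ^ card B"
    using B(1) by (simp add: card_funcsetE)
  finally show ?thesis using dim_basis[OF B] by simp
qed

lemma card_carrier_vec: "card (carrier_vec n :: 'a::{field,finite} vec set) = CARD('a) ^ n"
proof -
  interpret vec_space "TYPE('a)" n .
  have "vectorspace class_ring V"
    by (rule vec_vs)
  from card_finite_vectorspace[OF this] show ?thesis
    using finite_carrier_vec[of n, where ?'a = 'a] by (simp add: dim_is_n module_vec_simps)
qed

lemma is_subspace_iff:
  "is_subspace N U \<longleftrightarrow> U \<subseteq> carrier_vec N \<and> 0\<^sub>v N \<in> U \<and>
    (\<forall>u\<in>U. \<forall>v\<in>U. u + v \<in> U) \<and> (\<forall>c. \<forall>u\<in>U. c \<cdot>\<^sub>v u \<in> U)"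
  for U :: "'a::field vec set"
proof -
  interpret vec_space "TYPE('a)" N .
  show ?thesis
    unfolding is_subspace_def VectorSpace.subspace_def submodule_def
    using vec_vs[of N] vec_module[of N]
    by (auto simp: module_vec_simps)
qed

lemma card_subspace:
  fixes U :: "'a::{field,finite} vec set"
  assumes "is_subspace N U"
  shows "card U = CARD('a) ^ vectorspace.dim class_ring (module_vec TYPE('a) N\<lparr>carrier := U\<rparr>)"
proof -
  interpret vec_space "TYPE('a)" N .
  have "finite U"
    using assms finite_carrier_vec[of N] finite_subset by (auto simp: is_subspace_iff)
  moreover have "vectorspace class_ring (vs U)"
    using assms subspace_is_vs by (simp add: is_subspace_def)
  ultimately show ?thesis
    using card_finite_vectorspace[of "vs U"] by simp
qed

text \<open>Powers of \<open>CARD('a) > 1\<close> determine their exponent, so counting determines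
  the dimension. This lets codimensions over two different scalar fields be compared through a mere
  bijection.\<close>

lemma codimension_eq_if_card:
  fixes U :: "'a::{field,finite} vec set"
  assumes "is_subspace N U" and "card U = CARD('a) ^ d"
  shows "codimension N U = N - d"
  using card_subspace[OF assms(1)] assms(2) CARD_field_gt_1[where ?'a = 'a]
  by (simp add: codimension_def)

section \<open>Coordinates over a subfield\<close>

text \<open>Through \<open>\<phi>\<close>, the field \<open>'b\<close> becomes a vector space over
  \<open>'a\<close>; \<open>L\<close> sends a coordinate vector to the element it represents in an
  enumerated basis.\<close>

lemma vec_coordinates_over_subfield:
  fixes \<phi> :: "'a::{field,finite} \<Rightarrow> 'b::{field,finite}"
  assumes one: "\<phi> 1 = 1" and add: "\<And>x y. \<phi> (x + y) = \<phi> x + \<phi> y"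
    and mult: "\<And>x y. \<phi> (x * y) = \<phi> x * \<phi> y"
    and card: "CARD('b) = CARD('a) ^ m"
  obtains L :: "'a vec \<Rightarrow> 'b" where "bij_betw L (carrier_vec m) UNIV"
    and "\<And>u v. u \<in> carrier_vec m \<Longrightarrow> v \<in> carrier_vec m \<Longrightarrow> L (u + v) = L u + L v"
    and "\<And>c v. v \<in> carrier_vec m \<Longrightarrow> L (c \<cdot>\<^sub>v v) = \<phi> c * L v"
proof -
  have zero: "\<phi> 0 = 0"
    using add[of 0 0] by (metis add_cancel_left_left add_0_left)
  interpret b: vector_space "\<lambda>c x. \<phi> c * x"
    by unfold_locales (auto simp: one add mult algebra_simps)
  obtain B where B: "b.independent B" "b.span B = UNIV"
    using b.basis_exists[of UNIV] by (metis top.extremum_uniqueI)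
  define k where "k = card B"
  obtain f where f: "bij_betw f {..<k} B"
    using ex_bij_betw_nat_finite[of B] by (auto simp: k_def atLeast0LessThan)
  define L where "L v = (\<Sum>i<k. \<phi> (v $ i) * f i)" for v
  define coord where "coord v = (\<lambda>b. v $ inv_into {..<k} f b)" for v :: "'a vec"
  have f_inv: "inv_into {..<k} f (f i) = i" if "i < k" for i
    using f that by (simp add: bij_betw_inv_into_left)
  have L_sum: "(\<Sum>b\<in>B. \<phi> (u b) * b) = L (vec k (\<lambda>i. u (f i)))" for u
    unfolding L_def by (subst sum.reindex_bij_betw[OF f, symmetric]) simp
  have L_add: "L (u + v) = L u + L v" if "u \<in> carrier_vec k" "v \<in> carrier_vec k" for u v
    using that by (simp add: L_def add distrib_right sum.distrib)
  have L_smult: "L (c \<cdot>\<^sub>v v) = \<phi> c * L v" if "v \<in> carrier_vec k" for c v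
    using that by (simp add: L_def sum_distrib_left)
  have ker: "v $ i = 0" if "v \<in> carrier_vec k" "L v = 0" "i < k" for v i
  proof -
    have "(\<Sum>b\<in>B. \<phi> (coord v b) * b) = L v"
      unfolding L_sum by (simp add: L_def coord_def f_inv)
    then have "coord v (f i) = 0"
      using b.independentD[OF B(1) finite subset_refl, of "coord v" "f i"] that f
      by (auto simp: bij_betw_def)
    then show ?thesis using that by (simp add: coord_def f_inv)
  qed
  have "inj_on L (carrier_vec k)"
  proof (rule inj_onI)
    fix u v assume uv: "u \<in> carrier_vec k" "v \<in> carrier_vec k" "L u = L v"
    \<comment> \<open>The difference is written with the scalar -1 because \<open>L\<close> is known
      to respect only sums and scalar multiples. The cancellation is
      \<open>\<phi> 1 + \<phi> (-1) = \<phi> 0 = 0\<close>.\<close>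
    have "L (u + (-1) \<cdot>\<^sub>v v) = L u + \<phi> (-1) * L v"
      using uv by (simp add: L_add L_smult)
    also have "\<dots> = (\<phi> 1 + \<phi> (-1)) * L u"
      using uv by (simp add: one algebra_simps)
    also have "\<dots> = 0"
      using add[of 1 "-1"] zero by simp
    finally have "u $ i = v $ i" if "i < k" for i
      using ker[of "u + (-1) \<cdot>\<^sub>v v" i] uv that by simp
    then show "u = v" using uv by (intro eq_vecI) auto
  qed
  moreover have "x \<in> L ` carrier_vec k" for x
  proof -
    have "x \<in> b.span B" using B by simp
    then obtain u where "x = (\<Sum>b\<in>B. \<phi> (u b) * b)"
      using b.span_finite[of B] by auto
    then show ?thesis by (auto simp: L_sum)
  qed
  ultimately have bij: "bij_betw L (carrier_vec k) UNIV"
    by (auto simp: bij_betw_def)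
  \<comment> \<open>The size \<open>k\<close> of the basis is identified with \<open>m\<close> only
    here, by counting both sides of the bijection.\<close>
  then have "CARD('a) ^ k = CARD('a) ^ m"
    using bij_betw_same_card[OF bij] card by (simp add: card_carrier_vec)
  then have "k = m"
    using CARD_field_gt_1[where ?'a = 'a] by simp
  with bij L_add L_smult show thesis by (intro that[of L]) auto
qed

section \<open>The block shift as a power of the cyclic shift\<close>

lemma index_div_less: "i < n" if "j < m * n" "i = j div m" for i j m n :: nat
  using that by (metis less_mult_imp_div_less mult.commute)

lemma cyclic_shift_carrier: "cyclic_shift N u \<in> carrier_vec N"
  by (simp add: cyclic_shift_def)

lemma tau3_carrier: "tau3 m n u \<in> carrier_vec (m * n)"
  by (simp add: tau3_def of_blocks_def)

lemma funpow_closed: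
  assumes "\<And>v. v \<in> A \<Longrightarrow> T v \<in> A" and "v \<in> A"
  shows "(T ^^ k) v \<in> A"
  using assms by (induction k) auto

text \<open>Each shift moves one more entry from the end to the front. The bound
  \<open>k \<le> N\<close> means at most one wrap-around, so a case distinction replaces modular
  indices.\<close>

lemma cyclic_shift_funpow:
  assumes "u \<in> carrier_vec N" and "k \<le> N"
  shows "(cyclic_shift N ^^ k) u = vec N (\<lambda>j. if j < k then u $ (N - k + j) else u $ (j - k))"
  using assms(2)
proof (induction k)
  case 0
  with assms(1) show ?case by (intro eq_vecI) auto
next
  case (Suc k)
  then show ?case
    by (intro eq_vecI)
       (auto simp: cyclic_shift_def Suc_diff_Suc not_less less_Suc_eq_le
          intro!: arg_cong[where f = "vec_index u"])
qed

text \<open>Moving the last block to the front moves the last \<open>m\<close> entries there in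
  their order. Position \<open>j\<close> lies in block \<open>j div m\<close>, and stepping back one
  block subtracts \<open>m\<close> from \<open>j\<close>, except in block 0, which receives the last
  block.\<close>

lemma tau3_eq_cyclic_shift_funpow:
  assumes "v \<in> carrier_vec (m * n)" and "m > 0" and "n > 0"
  shows "tau3 m n v = (cyclic_shift (m * n) ^^ m) v"
proof (rule eq_vecI)
  have m: "m \<le> m * n" using assms(3) by simp
  fix j assume "j < dim_vec ((cyclic_shift (m * n) ^^ m) v)"
  then have j: "j < m * n" by (simp add: cyclic_shift_funpow[OF assms(1) m])
  have "tau3 m n v $ j = (if j div m = 0 then v $ ((n - 1) * m + j mod m) else v $ ((j div m - 1) * m + j mod m))"
    using j assms(2) by (simp add: tau3_def of_blocks_def block_def)
  also have "\<dots> = (if j < m then v $ (m * n - m + j) else v $ (j - m))"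
  proof (cases "j < m")
    case True
    then show ?thesis by (simp add: algebra_simps)
  next
    case False
    then have "(j div m - 1) * m + j mod m = j - m"
      using assms(2) by (metis le_div_geq diff_Suc_1 div_mult_mod_eq le_mod_geq not_less)
    moreover have "j div m \<noteq> 0"
      using False assms(2) by (simp add: div_eq_0_iff)
    ultimately show ?thesis using False by simp
  qed
  finally show "tau3 m n v $ j = (cyclic_shift (m * n) ^^ m) v $ j"
    using j by (simp add: cyclic_shift_funpow[OF assms(1) m])
qed (use assms(3) in \<open>simp add: cyclic_shift_funpow[OF assms(1)] tau3_def of_blocks_def\<close>)

text \<open>The \<open>k\<close>-th power of \<open>tau3\<close> is the \<open>m * k\<close>-th
  power of the cyclic shift, and \<open>k < n\<close> gives \<open>m * k < m * n\<close>. So the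
  translates of \<open>U\<close> under \<open>tau3\<close> are among its cyclic translates.\<close>

lemma is_covering_cyclic_shift_if_tau3:
  fixes U :: "'a::field vec set"
  assumes cov: "is_covering (tau3 m n) n (m * n) U" and "m > 0" and "n > 0"
  shows "is_covering (cyclic_shift (m * n)) (m * n) (m * n) U"
proof -
  let ?C = "carrier_vec (m * n) :: 'a vec set"
  have sub: "is_subspace (m * n) U" using cov by (simp add: is_covering_def)
  then have U: "U \<subseteq> ?C" by (simp add: is_subspace_iff)
  have tau: "(tau3 m n ^^ k) u = (cyclic_shift (m * n) ^^ (m * k)) u" if "u \<in> ?C" for k u
  proof (induction k)
    case (Suc k)
    have "(cyclic_shift (m * n) ^^ (m * k)) u \<in> ?C"
      using that by (intro funpow_closed cyclic_shift_carrier)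
    then show ?case
      using Suc by (simp add: tau3_eq_cyclic_shift_funpow[OF _ assms(2,3)] funpow_add)
  qed simp
  have "?C \<subseteq> (\<Union>i\<in>{0..<m * n}. (cyclic_shift (m * n) ^^ i) ` U)"
  proof
    fix v assume "v \<in> ?C"
    then have "v \<in> (\<Union>i\<in>{0..<n}. (tau3 m n ^^ i) ` U)"
      using cov by (simp add: is_covering_def)
    then obtain k u where "k < n" "u \<in> U" "v = (tau3 m n ^^ k) u"
      by auto
    then have "v = (cyclic_shift (m * n) ^^ (m * k)) u" and "m * k < m * n"
      using tau U \<open>m > 0\<close> by auto
    with \<open>u \<in> U\<close> show "v \<in> (\<Union>i\<in>{0..<m * n}. (cyclic_shift (m * n) ^^ i) ` U)"
      by (intro UN_I[of "m * k"]) auto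
  qed
  moreover have "(cyclic_shift (m * n) ^^ i) ` U \<subseteq> ?C" for i
    using U by (auto intro!: funpow_closed cyclic_shift_carrier)
  ultimately show ?thesis
    using sub by (auto simp: is_covering_def)
qed

section \<open>Bounds by and attainment of the maxima\<close>

lemma codimension_le_h_cyclic:
  fixes U :: "'a::{field,finite} vec set"
  assumes "is_covering (cyclic_shift N) N N U"
  shows "codimension N U \<le> h_cyclic TYPE('a) N"
  unfolding h_cyclic_def using assms finite_codimensions by (intro Max_ge) auto

lemma h_cyclic_attained:
  assumes "N > 0"
  obtains U :: "'a::{field,finite} vec set" where "is_covering (cyclic_shift N) N N U"
    and "codimension N U = h_cyclic TYPE('a) N"
proof -
  have "is_covering (cyclic_shift N) N N (carrier_vec N :: 'a vec set)"
    using assms by (intro is_covering_carrier_vec cyclic_shift_carrier)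
  then have "h_cyclic TYPE('a) N \<in> {codimension N U | U :: 'a vec set. is_covering (cyclic_shift N) N N U}"
    unfolding h_cyclic_def using finite_codimensions by (intro Max_in) auto
  then show thesis using that by auto
qed

lemma h_tau3_attained:
  assumes "n > 0"
  obtains U :: "'a::{field,finite} vec set" where "is_covering (tau3 m n) n (m * n) U"
    and "codimension (m * n) U = h_tau3 TYPE('a) m n"
proof -
  have "is_covering (tau3 m n) n (m * n) (carrier_vec (m * n) :: 'a vec set)"
    using assms by (intro is_covering_carrier_vec tau3_carrier)
  then have "h_tau3 TYPE('a) m n \<in>
      {codimension (m * n) U | U :: 'a vec set. is_covering (tau3 m n) n (m * n) U}"
    unfolding h_tau3_def using finite_codimensions by (intro Max_in) auto
  then show thesis using that by auto
qed

lemma h_tau3_le_h_cyclic: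
  assumes "m > 0" and "n > 0"
  shows "h_tau3 TYPE('a::{field,finite}) m n \<le> h_cyclic TYPE('a) (m * n)"
  using h_tau3_attained[OF assms(2), where ?'a = 'a and m = m] codimension_le_h_cyclic
    is_covering_cyclic_shift_if_tau3[OF _ assms] by metis

section \<open>Transfer of coverings from the larger field to blocks\<close>

lemma block_index_less:
  assumes "i < n" and "r < m"
  shows "i * m + r < m * (n :: nat)"
proof -
  have "i * m + r < Suc i * m" using assms(2) by simp
  also have "\<dots> \<le> n * m" using assms(1) by (intro mult_le_mono1) simp
  finally show ?thesis by (simp add: mult.commute)
qed

lemma block_of_blocks:
  assumes "i < n" and "b i \<in> carrier_vec m"
  shows "block m (of_blocks m n b) i = b i"
proof (rule eq_vecI)
  fix r assume "r < dim_vec (b i)"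
  then have r: "r < m" using assms(2) by auto
  then show "block m (of_blocks m n b) i $ r = b i $ r"
    using block_index_less[OF assms(1) r] by (simp add: block_def of_blocks_def)
qed (use assms in \<open>simp add: block_def\<close>)

lemma of_blocks_block:
  assumes "v \<in> carrier_vec (m * n)"
  shows "of_blocks m n (block m v) = v"
proof (rule eq_vecI)
  fix j assume "j < dim_vec v"
  then have "j < m * n" using assms by simp
  then have "m > 0" by (cases m) auto
  with \<open>j < m * n\<close> show "of_blocks m n (block m v) $ j = v $ j"
    by (simp add: of_blocks_def block_def)
qed (use assms in \<open>simp add: of_blocks_def\<close>)

lemma of_blocks_cong:
  assumes "\<And>i. i < n \<Longrightarrow> b i = c i"
  shows "of_blocks m n b = of_blocks m n c"
  using assms by (intro eq_vecI) (auto simp: of_blocks_def index_div_less)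

lemma block_add:
  assumes "u \<in> carrier_vec (m * n)" and "v \<in> carrier_vec (m * n)" and "i < n"
  shows "block m (u + v) i = block m u i + block m v i"
  using assms block_index_less[OF assms(3)] by (intro eq_vecI) (auto simp: block_def)

lemma block_smult:
  assumes "v \<in> carrier_vec (m * n)" and "i < n"
  shows "block m (c \<cdot>\<^sub>v v) i = c \<cdot>\<^sub>v block m v i"
  using assms block_index_less[OF assms(2)] by (intro eq_vecI) (auto simp: block_def)

lemma block_carrier [simp]: "block m v i \<in> carrier_vec m"
  by (simp add: block_def)

text \<open>\<open>W\<close> is the preimage of \<open>U\<close> under the blockwise coordinate map
  \<open>\<Lambda>\<close>. This bijection carries \<open>tau3\<close> to the cyclic shift and is
  semilinear along \<open>\<phi>\<close>, so \<open>W\<close> is a covering subspace over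
  \<open>'a\<close>; its codimension is found by counting.\<close>

lemma tau3_covering_of_cyclic_covering:
  fixes U :: "'b::{field,finite} vec set"
  assumes card: "CARD('b) = CARD('a::{field,finite}) ^ m" and "n > 0"
    and cov: "is_covering (cyclic_shift n) n n U"
  obtains W :: "'a::{field,finite} vec set" where "is_covering (tau3 m n) n (m * n) W"
    and "codimension (m * n) W = m * codimension n U"
proof -
  obtain \<phi> :: "'a \<Rightarrow> 'b" where one: "\<phi> 1 = 1" and add: "\<And>x y. \<phi> (x + y) = \<phi> x + \<phi> y"
    and mult: "\<And>x y. \<phi> (x * y) = \<phi> x * \<phi> y"
    using finite_field_embedding[OF card] by blast
  obtain L :: "'a vec \<Rightarrow> 'b" where L: "bij_betw L (carrier_vec m) UNIV"
    and L_add: "\<And>u v. u \<in> carrier_vec m \<Longrightarrow> v \<in> carrier_vec m \<Longrightarrow> L (u + v) = L u + L v"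
    and L_smult: "\<And>c v. v \<in> carrier_vec m \<Longrightarrow> L (c \<cdot>\<^sub>v v) = \<phi> c * L v"
    using vec_coordinates_over_subfield[OF one add mult card] by blast
  let ?C = "carrier_vec (m * n) :: 'a vec set"
  define \<Lambda> where "\<Lambda> v = vec n (\<lambda>i. L (block m v i))" for v
  have \<Lambda>_carrier: "\<Lambda> v \<in> carrier_vec n" for v
    by (simp add: \<Lambda>_def)
  have inj: "inj_on \<Lambda> ?C"
  proof (rule inj_onI)
    fix u v assume uv: "u \<in> ?C" "v \<in> ?C" "\<Lambda> u = \<Lambda> v"
    have "block m u i = block m v i" if "i < n" for i
    proof (rule inj_onD[OF bij_betw_imp_inj_on[OF L]])
      have "\<Lambda> u $ i = \<Lambda> v $ i" using uv by simp
      then show "L (block m u i) = L (block m v i)" using that by (simp add: \<Lambda>_def)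
    qed simp_all
    then show "u = v" using of_blocks_cong of_blocks_block uv by metis
  qed
  have surj: "\<exists>v\<in>?C. \<Lambda> v = w" if "w \<in> carrier_vec n" for w
  proof -
    define b where "b i = inv_into (carrier_vec m) L (w $ i)" for i
    have b: "b i \<in> carrier_vec m" "L (b i) = w $ i" for i
      using L by (auto simp: b_def bij_betw_def inv_into_into f_inv_into_f)
    have "\<Lambda> (of_blocks m n b) = w"
      using that b by (intro eq_vecI) (auto simp: \<Lambda>_def block_of_blocks)
    then show ?thesis by (intro bexI) (auto simp: of_blocks_def)
  qed
  have shift: "\<Lambda> (tau3 m n v) = cyclic_shift n (\<Lambda> v)" for v
    using \<open>n > 0\<close> by (intro eq_vecI) (auto simp: \<Lambda>_def cyclic_shift_def tau3_def block_of_blocks)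
  have shift_pow: "\<Lambda> ((tau3 m n ^^ k) v) = (cyclic_shift n ^^ k) (\<Lambda> v)" for k v
    by (induction k) (simp_all add: shift)
  have sub: "is_subspace n U" and U: "(\<Union>i\<in>{0..<n}. (cyclic_shift n ^^ i) ` U) = carrier_vec n"
    using cov by (simp_all add: is_covering_def)
  have U_carrier: "U \<subseteq> carrier_vec n" using sub by (simp add: is_subspace_iff)
  define W where "W = {v \<in> ?C. \<Lambda> v \<in> U}"
  have \<Lambda>_add: "\<Lambda> (u + v) = \<Lambda> u + \<Lambda> v" if "u \<in> ?C" "v \<in> ?C" for u v
    using that by (intro eq_vecI) (auto simp: \<Lambda>_def block_add L_add)
  have \<Lambda>_smult: "\<Lambda> (c \<cdot>\<^sub>v v) = \<phi> c \<cdot>\<^sub>v \<Lambda> v" if "v \<in> ?C" for c v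
    using that by (intro eq_vecI) (auto simp: \<Lambda>_def block_smult L_smult)
  have "L (0\<^sub>v m) = 0"
    using L_add[of "0\<^sub>v m" "0\<^sub>v m"]
    by (metis add_cancel_left_left left_zero_vec zero_carrier_vec)
  moreover have "block m (0\<^sub>v (m * n)) i = (0\<^sub>v m :: 'a vec)" if "i < n" for i
    using block_index_less[OF that] by (intro eq_vecI) (auto simp: block_def)
  ultimately have "\<Lambda> (0\<^sub>v (m * n)) = 0\<^sub>v n"
    by (intro eq_vecI) (auto simp: \<Lambda>_def)
  then have W_sub: "is_subspace (m * n) W"
    using sub by (auto simp: W_def is_subspace_iff \<Lambda>_add \<Lambda>_smult)
  have "bij_betw \<Lambda> W U"
    unfolding bij_betw_def
  proof
    show "inj_on \<Lambda> W" using inj by (rule inj_on_subset) (auto simp: W_def)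
    show "\<Lambda> ` W = U" using surj U_carrier by (force simp: W_def)
  qed
  then have "card W = CARD('b) ^ vectorspace.dim class_ring (module_vec TYPE('b) n\<lparr>carrier := U\<rparr>)"
    using card_subspace[OF sub] by (simp add: bij_betw_same_card)
  \<comment> \<open>With \<open>d\<close> the dimension of \<open>U\<close>, the size of
    \<open>W\<close> is \<open>CARD('a) ^ (m * d)\<close>, and
    \<open>m * n - m * d = m * (n - d)\<close> holds for truncated subtraction too.\<close>
  then have codim: "codimension (m * n) W = m * codimension n U"
    using codimension_eq_if_card[OF W_sub]
    by (simp add: card codimension_def right_diff_distrib' flip: power_mult)
  have "v \<in> (\<Union>i\<in>{0..<n}. (tau3 m n ^^ i) ` W)" if "v \<in> ?C" for v
  proof -
    have "\<Lambda> v \<in> (\<Union>i\<in>{0..<n}. (cyclic_shift n ^^ i) ` U)"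
      using \<Lambda>_carrier U by blast
    then obtain k u where k: "k < n" "u \<in> U" "\<Lambda> v = (cyclic_shift n ^^ k) u"
      by auto
    then obtain w where w: "w \<in> ?C" "\<Lambda> w = u" using surj U_carrier by blast
    \<comment> \<open>This vector and \<open>v\<close> have the same image under
      \<open>\<Lambda>\<close>; injectivity on the carrier identifies them.\<close>
    have "(tau3 m n ^^ k) w \<in> ?C" using w(1) by (intro funpow_closed tau3_carrier)
    then have "v = (tau3 m n ^^ k) w"
      using inj_onD[OF inj _ that] shift_pow k w by metis
    then show ?thesis using k w by (auto simp: W_def)
  qed
  moreover have "(tau3 m n ^^ i) ` W \<subseteq> ?C" for i
    by (auto simp: W_def intro!: funpow_closed tau3_carrier)
  ultimately have "is_covering (tau3 m n) n (m * n) W"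
    using W_sub by (auto simp: is_covering_def)
  with codim show thesis by (rule that[rotated])
qed

section \<open>Vanishing over the larger field\<close>

theorem theorem4p3:
  fixes q m n :: nat
  assumes "CARD('a::{field,finite}) = q" and "m > 0" and "n > 0"
  shows "(h_cyclic TYPE('a) (m * n) = 0 \<longrightarrow>
            h_tau3 TYPE('a) m n = 0 \<and>
            (CARD('b::{field,finite}) = q ^ m \<longrightarrow> h_cyclic TYPE('b) n = 0)) \<and>
         (h_cyclic TYPE('a) (m * n) \<le> m - 1 \<longrightarrow>
            (CARD('b) = q ^ m \<longrightarrow> h_cyclic TYPE('b) n = 0))"
proof -
  have zero: "h_cyclic TYPE('b) n = 0"
    if le: "h_cyclic TYPE('a) (m * n) \<le> m - 1" and card: "CARD('b) = q ^ m"
  proof -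
    obtain U :: "'b vec set" where U: "is_covering (cyclic_shift n) n n U"
      "codimension n U = h_cyclic TYPE('b) n"
      using h_cyclic_attained[OF \<open>n > 0\<close>] by blast
    obtain W :: "'a vec set" where W: "is_covering (tau3 m n) n (m * n) W"
      "codimension (m * n) W = m * codimension n U"
      using tau3_covering_of_cyclic_covering[OF card[folded assms(1)] \<open>n > 0\<close> U(1)] by blast
    have "m * h_cyclic TYPE('b) n \<le> h_cyclic TYPE('a) (m * n)"
      using codimension_le_h_cyclic[OF is_covering_cyclic_shift_if_tau3[OF W(1) \<open>m > 0\<close> \<open>n > 0\<close>]]
      by (simp add: W(2) U(2))
    \<comment> \<open>A strict bound by \<open>m\<close> is what forces the factor
      \<open>h_cyclic TYPE('b) n\<close> to be 0. It needs \<open>m > 0\<close>, as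
      \<open>m - 1\<close> is truncated.\<close>
    also have "\<dots> < m * 1"
      using le \<open>m > 0\<close> by simp
    finally show ?thesis by simp
  qed
  \<comment> \<open>The hypothesis \<open>h_cyclic TYPE('a) (m * n) = 0\<close> is a special case of
    the bound by \<open>m - 1\<close>, so \<open>zero\<close> serves both implications.\<close>
  show ?thesis
    using zero h_tau3_le_h_cyclic[OF assms(2,3), where ?'a = 'a] by auto
qed

end
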